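(* Let $M\ge1$ and let $\tau_1,\dots,\tau_N$ be sporadic tasks with constrained deadlines ($D_i\le T_i$), indexed so that $D_1\le\cdots\le D_N$. Consider the deadline-monotonic partitioning algorithm with $M$ unit-speed processors, any fitting strategy, and the hyperbolic test: $\tau_k$ can be added to processor $m$ holding ${\bf T}_m$ iff $$\Big(\frac{C_k+\sum_{\tau_i\in{\bf T}_m^2}C_i}{D_k}+1\Big)\prod_{\tau_j\in{\bf T}_m^1}(U_j+1)\le 2,$$ where ${\bf T}_m^1=\{\tau_i\in{\bf T}_m: T_i<D_k\}$ and ${\bf T}_m^2=\{\tau_i\in{\bf T}_m: T_i\ge D_k\}$. Suppose the algorithm has assigned $\tau_1,\dots,\tau_{k-1}$ and now considers $\tau_k$. Let ${\bf T}^{*1}=\{\tau_i: i<k,\ T_i<D_k\}$, ${\bf T}^{*2}=\{\tau_i: i<k,\ T_i\ge D_k\}$, and $C_k'=C_k+\frac1M\sum_{\tau_i\in{\bf T}^{*2}}C_i$. If $$\prod_{\tau_i\in{\bf T}^{*1}}\Big(1+\frac{U_i}{M}\Big)\le\frac{2}{1+\frac{C_k'}{D_k}},$$ then some processor passes the test for $\tau_k$, i.e., the algorithm succeeds in assigning $\tau_k$.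
   Context: A sporadic task $\tau_i=(C_i,T_i,D_i)$ has worst-case execution time $C_i>0$, minimum inter-arrival time $T_i>0$, relative deadline $D_i>0$; $U_i=C_i/T_i$. Deadline-monotonic partitioning algorithm: tasks indexed by non-decreasing relative deadline; ${\bf T}_1=\{\tau_1\}$, ${\bf T}_m=\emptyset$ for $m\ge2$; for $k=2,\dots,N$, if some processor $m$ has ${\bf T}_m\cup\{\tau_k\}$ passing the test, choose one such $m$ by the fitting strategy (any rule) and add $\tau_k$ to ${\bf T}_m$, else return failure. *)

theory Defs
  imports Complex_Main
begin

record task =
  wcet :: real
  period :: real
  deadline :: real

definition sporadic_task :: "task \<Rightarrow> bool" where
  "sporadic_task t \<longleftrightarrow> wcet t > 0 \<and> period t > 0 \<and> deadline t > 0"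

definition constrained_deadline :: "task \<Rightarrow> bool" where
  "constrained_deadline t \<longleftrightarrow> deadline t \<le> period t"

definition utilization :: "task \<Rightarrow> real" where
  "utilization t = wcet t / period t"

text \<open>
  A task system is a family \<open>\<tau> :: nat \<Rightarrow> task\<close> used on the indices \<open>1..N\<close>. Sets of tasks
  are represented by sets of indices, so distinct tasks with equal parameters stay distinct.
\<close>

definition short_period_tasks :: "(nat \<Rightarrow> task) \<Rightarrow> nat \<Rightarrow> nat set \<Rightarrow> nat set" where
  "short_period_tasks \<tau> k A = {i \<in> A. period (\<tau> i) < deadline (\<tau> k)}"

definition long_period_tasks :: "(nat \<Rightarrow> task) \<Rightarrow> nat \<Rightarrow> nat set \<Rightarrow> nat set" where
  "long_period_tasks \<tau> k A = {i \<in> A. period (\<tau> i) \<ge> deadline (\<tau> k)}"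

definition hyperbolic_test :: "(nat \<Rightarrow> task) \<Rightarrow> nat set \<Rightarrow> nat \<Rightarrow> bool" where
  "hyperbolic_test \<tau> A k \<longleftrightarrow>
     ((wcet (\<tau> k) + (\<Sum>i\<in>long_period_tasks \<tau> k A. wcet (\<tau> i))) / deadline (\<tau> k) + 1) *
     (\<Prod>j\<in>short_period_tasks \<tau> k A. utilization (\<tau> j) + 1) \<le> 2"

text \<open>
  An assignment maps each processor in \<open>1..M\<close> to the set of tasks it holds. A fitting strategy
  receives the current assignment, the task under consideration and the nonempty set of
  processors passing the test, and returns one of the latter. As the assignment records the
  indices of all tasks placed so far, this includes history-dependent rules such as next-fit.
\<close>

type_synonym assignment = "nat \<Rightarrow> nat set"
type_synonym strategy = "assignment \<Rightarrow> nat \<Rightarrow> nat set \<Rightarrow> nat"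

definition fitting_strategy :: "nat \<Rightarrow> strategy \<Rightarrow> bool" where
  "fitting_strategy M sel \<longleftrightarrow>
     (\<forall>P k A. A \<subseteq> {1..M} \<and> A \<noteq> {} \<longrightarrow> sel P k A \<in> A)"

definition passing_processors ::
  "nat \<Rightarrow> (nat set \<Rightarrow> nat \<Rightarrow> bool) \<Rightarrow> assignment \<Rightarrow> nat \<Rightarrow> nat set" where
  "passing_processors M test P k = {m \<in> {1..M}. test (P m) k}"

definition assign :: "assignment \<Rightarrow> nat \<Rightarrow> nat \<Rightarrow> assignment" where
  "assign P m k = P(m := insert k (P m))"

text \<open>
  \<open>dm_partition M test sel n\<close> is the outcome of the partitioning algorithm after treating the
  tasks \<open>1..n\<close>: \<open>None\<close> means failure. The tasks are treated by increasing index, hence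
  deadline-monotonically once the indexing is by non-decreasing deadline. Task 1 is put on
  processor 1 without any test.
\<close>

fun dm_partition ::
  "nat \<Rightarrow> (nat set \<Rightarrow> nat \<Rightarrow> bool) \<Rightarrow> strategy \<Rightarrow> nat \<Rightarrow> assignment option" where
  "dm_partition M test sel 0 = Some (\<lambda>m. {})"
| "dm_partition M test sel (Suc 0) = Some (assign (\<lambda>m. {}) 1 1)"
| "dm_partition M test sel (Suc (Suc n)) =
     (case dm_partition M test sel (Suc n) of
        None \<Rightarrow> None
      | Some P \<Rightarrow>
          (let k = Suc (Suc n); A = passing_processors M test P k
           in if A = {} then None else Some (assign P (sel P k A) k)))"

definition inflated_wcet :: "nat \<Rightarrow> (nat \<Rightarrow> task) \<Rightarrow> nat \<Rightarrow> real" where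
  "inflated_wcet M \<tau> k =
     wcet (\<tau> k) + 1 / real M * (\<Sum>i\<in>long_period_tasks \<tau> k {1..<k}. wcet (\<tau> i))"

end

theory Submission
  imports Defs "HOL-Analysis.Convex" "HOL-Library.Disjoint_Sets"
begin

text \<open>
  If every processor rejects the task, then multiplying the \<open>M\<close> violated tests gives a product
  exceeding \<open>2 ^ M\<close>. The long-period factors are bounded by the \<open>M\<close>-th power of their mean
  (AM-GM), and each short-period task contributes
  \<open>1 + U \<le> (1 + U / M) ^ M\<close> (Bernoulli), so the \<open>M\<close>-th power of the hypothesis is contradicted.
\<close>

text \<open>Along the run of the algorithm each new index is fresh and enters exactly one processor
  of \<open>{1..M}\<close>; \<open>M \<ge> 1\<close> makes room for task 1 on processor 1. Later
  this turns products and sums over processors into ones over all earlier tasks.\<close>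

lemma dm_partition_partitions:
  assumes "M \<ge> 1" "fitting_strategy M sel" "dm_partition M test sel n = Some P"
  shows "(\<Union>m\<in>{1..M}. P m) = {1..n}" and "disjoint_family_on P {1..M}"
proof -
  have "(\<Union>m\<in>{1..M}. P m) = {1..n} \<and> disjoint_family_on P {1..M}"
    using assms
  proof (induction M test sel n arbitrary: P rule: dm_partition.induct)
    case 1
    then show ?case by (auto simp: disjoint_family_on_def)
  next
    case 2
    then show ?case
      by (auto simp: disjoint_family_on_def assign_def split: if_splits)
  next
    case (3 M test sel n)
    define k where "k = Suc (Suc n)"
    obtain Q where Q: "dm_partition M test sel (Suc n) = Some Q"
      using 3 by (auto split: option.splits)
    define A where "A = passing_processors M test Q k"
    have "A \<noteq> {}" and P: "P = assign Q (sel Q k A) k"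
      using 3 Q by (auto simp: A_def k_def Let_def split: if_splits)
    moreover have "A \<subseteq> {1..M}"
      by (auto simp: A_def passing_processors_def)
    ultimately have s: "sel Q k A \<in> {1..M}"
      using 3(3) unfolding fitting_strategy_def by blast
    have U: "(\<Union>m\<in>{1..M}. Q m) = {1..Suc n}" and D: "disjoint_family_on Q {1..M}"
      using 3(1)[OF 3(2,3) Q] by simp_all
    \<comment> \<open>Only indices up to \<open>Suc n\<close> are placed so far, so inserting
      \<open>k\<close> into a single part cannot destroy disjointness.\<close>
    have "k \<notin> (\<Union>m\<in>{1..M}. Q m)"
      unfolding U k_def by simp
    then have "k \<notin> Q m" if "m \<in> {1..M}" for m
      using that by blast
    then have "disjoint_family_on P {1..M}"
      using D unfolding P assign_def disjoint_family_on_def by auto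
    moreover have "(\<Union>m\<in>{1..M}. P m) = insert k (\<Union>m\<in>{1..M}. Q m)"
      using s unfolding P assign_def by (auto split: if_splits)
    ultimately show ?case
      unfolding U by (auto simp: k_def)
  qed
  then show "(\<Union>m\<in>{1..M}. P m) = {1..n}" "disjoint_family_on P {1..M}" by auto
qed

text \<open>The AM-GM inequality freed of its root by raising both sides to the power
  \<open>card S\<close>.\<close>

lemma prod_le_mean_power:
  fixes x :: "'a \<Rightarrow> real"
  assumes "finite S" "S \<noteq> {}" "\<And>i. i \<in> S \<Longrightarrow> x i \<ge> 0"
  shows "(\<Prod>i\<in>S. x i) \<le> ((\<Sum>i\<in>S. x i) / card S) ^ card S"
proof -
  have nn: "(\<Prod>i\<in>S. x i) \<ge> 0" and c: "card S > 0"
    using assms by (auto simp: prod_nonneg card_gt_0_iff)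
  have "(\<Prod>i\<in>S. x i) = ((\<Prod>i\<in>S. x i) powr (1 / card S)) ^ card S"
    \<comment> \<open>A vanishing product is treated apart, with
      \<open>0 powr x = 0\<close>.\<close>
    using nn c by (cases "(\<Prod>i\<in>S. x i) = 0") (simp_all add: powr_power)
  also have "\<dots> \<le> (\<Sum>i\<in>S. x i / card S) ^ card S"
    using arith_geom_mean[OF assms] by (intro power_mono) auto
  finally show ?thesis by (simp add: sum_divide_distrib)
qed

text \<open>The analytic core, detached from scheduling: \<open>I\<close> stands for the processors,
  \<open>L m\<close> and \<open>S m\<close> for the long-period and short-period tasks on
  \<open>m\<close>, \<open>a\<close> and \<open>c\<close> for execution times divided by the
  deadline of the new task, \<open>u\<close> for utilizations and \<open>b\<close> for the bound
  2.\<close>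

lemma exists_passing_part:
  fixes a :: real and c u :: "'a \<Rightarrow> real" and L S :: "'b \<Rightarrow> 'a set"
  assumes I: "finite I" "I \<noteq> {}"
    and L: "\<And>m. m \<in> I \<Longrightarrow> finite (L m)" "disjoint_family_on L I"
    and S: "\<And>m. m \<in> I \<Longrightarrow> finite (S m)" "disjoint_family_on S I"
    and a: "a \<ge> 0"
    and c: "\<And>i. i \<in> \<Union> (L ` I) \<Longrightarrow> c i \<ge> 0"
    and u: "\<And>i. i \<in> \<Union> (S ` I) \<Longrightarrow> u i \<ge> 0"
    and le: "(1 + a + (\<Sum>i\<in>\<Union> (L ` I). c i) / card I) * (\<Prod>i\<in>\<Union> (S ` I). 1 + u i / card I) \<le> b"
  shows "\<exists>m\<in>I. (1 + a + (\<Sum>i\<in>L m. c i)) * (\<Prod>i\<in>S m. 1 + u i) \<le> b"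
proof (rule ccontr)
  assume "\<not> ?thesis"
  then have gt: "b < (1 + a + (\<Sum>i\<in>L m. c i)) * (\<Prod>i\<in>S m. 1 + u i)" if "m \<in> I" for m
    using that by force
  let ?M = "card I"
  have M: "?M > 0" using I by (simp add: card_gt_0_iff)
  let ?A = "1 + a + (\<Sum>i\<in>\<Union> (L ` I). c i) / ?M"
  let ?B = "\<Prod>i\<in>\<Union> (S ` I). 1 + u i / ?M"
  have A: "?A \<ge> 0" using a c by (intro add_nonneg_nonneg divide_nonneg_nonneg sum_nonneg) auto
  have B: "?B \<ge> 0" using u by (intro prod_nonneg add_nonneg_nonneg divide_nonneg_nonneg) auto
  have pos: "1 + a + (\<Sum>i\<in>L m. c i) \<ge> 0" if "m \<in> I" for m
    using that a c by (intro add_nonneg_nonneg sum_nonneg) auto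
  \<comment> \<open>The sign of \<open>b\<close> is forced by \<open>le\<close>; it is what allows
    the violated inequalities to be multiplied.\<close>
  have b: "b \<ge> 0" using mult_nonneg_nonneg[OF A B] le by linarith
  have "b ^ ?M = (\<Prod>m\<in>I. b)" by simp
  also have "\<dots> < (\<Prod>m\<in>I. (1 + a + (\<Sum>i\<in>L m. c i)) * (\<Prod>i\<in>S m. 1 + u i))"
  proof -
    obtain m where "m \<in> I" using I by blast
    then show ?thesis
      using I(1) b by (intro prod_mono_strict[of m])
        (simp_all add: gt less_imp_le[OF gt] le_less_trans[OF b gt])
  qed
  also have "\<dots> = (\<Prod>m\<in>I. 1 + a + (\<Sum>i\<in>L m. c i)) * (\<Prod>i\<in>\<Union> (S ` I). 1 + u i)"
    using I S by (simp add: prod.distrib prod.UNION_disjoint disjoint_family_on_def)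
  also have "\<dots> \<le> ?A ^ ?M * ?B ^ ?M"
  proof (rule mult_mono)
    have "(\<Prod>m\<in>I. 1 + a + (\<Sum>i\<in>L m. c i)) \<le> ((\<Sum>m\<in>I. 1 + a + (\<Sum>i\<in>L m. c i)) / ?M) ^ ?M"
      using I pos by (rule prod_le_mean_power)
    \<comment> \<open>The summand \<open>1 + a\<close> occurs once per part while the
      \<open>c i\<close> are spread over disjoint parts, so the mean is exactly
      \<open>?A\<close>.\<close>
    also have "(\<Sum>m\<in>I. 1 + a + (\<Sum>i\<in>L m. c i)) = ?M * (1 + a) + (\<Sum>i\<in>\<Union> (L ` I). c i)"
      using I L by (simp add: sum.distrib sum.UNION_disjoint disjoint_family_on_def algebra_simps)
    also have "\<dots> / ?M = ?A" using M by (simp add: field_simps)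
    finally show "(\<Prod>m\<in>I. 1 + a + (\<Sum>i\<in>L m. c i)) \<le> ?A ^ ?M" .
    have "1 + u i \<le> (1 + u i / ?M) ^ ?M" if "i \<in> \<Union> (S ` I)" for i
    proof -
      have "u i / ?M \<ge> 0" using u[OF that] by simp
      then have "1 + ?M * (u i / ?M) \<le> (1 + u i / ?M) ^ ?M"
        by (intro Bernoulli_inequality) linarith
      then show ?thesis using M by simp
    qed
    then show "(\<Prod>i\<in>\<Union> (S ` I). 1 + u i) \<le> ?B ^ ?M"
      using u by (subst prod_power_distrib) (force intro!: prod_mono)
    show "?A ^ ?M \<ge> 0" using A by (rule zero_le_power)
    show "(\<Prod>i\<in>\<Union> (S ` I). 1 + u i) \<ge> 0" using u by (intro prod_nonneg add_nonneg_nonneg) auto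
  qed
  also have "\<dots> = (?A * ?B) ^ ?M" by (simp add: power_mult_distrib)
  also have "\<dots> \<le> b ^ ?M" using le A B by (intro power_mono) auto
  finally show False by simp
qed

theorem theorem7:
  fixes M N k :: nat and \<tau> :: "nat \<Rightarrow> task" and sel :: strategy and P :: assignment
  assumes "M \<ge> 1"
    and "\<forall>i\<in>{1..N}. sporadic_task (\<tau> i) \<and> constrained_deadline (\<tau> i)"
    and "mono_on {1..N} (\<lambda>i. deadline (\<tau> i))"
    and "fitting_strategy M sel"
    and "k \<in> {2..N}"
    and "dm_partition M (hyperbolic_test \<tau>) sel (k - 1) = Some P"
    and "(\<Prod>i\<in>short_period_tasks \<tau> k {1..<k}. 1 + utilization (\<tau> i) / real M)
           \<le> 2 / (1 + inflated_wcet M \<tau> k / deadline (\<tau> k))"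
  shows "\<exists>m\<in>{1..M}. hyperbolic_test \<tau> (P m) k \<and>
           dm_partition M (hyperbolic_test \<tau>) sel k = Some (assign P m k)"
proof -
  let ?D = "deadline (\<tau> k)" and ?test = "hyperbolic_test \<tau>"
  let ?L = "\<lambda>m. long_period_tasks \<tau> k (P m)" and ?S = "\<lambda>m. short_period_tasks \<tau> k (P m)"
  have "{1..k - 1} = {1..<k}" using assms(5) by auto
  then have U: "(\<Union>m\<in>{1..M}. P m) = {1..<k}" and disj: "disjoint_family_on P {1..M}"
    using dm_partition_partitions[OF assms(1,4,6)] by auto
  \<comment> \<open>Whether a task is long or short depends on the task and \<open>k\<close> alone,
    not on its processor, so the classification commutes with the union.\<close>
  have L: "\<Union> (?L ` {1..M}) = long_period_tasks \<tau> k {1..<k}"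
    and S: "\<Union> (?S ` {1..M}) = short_period_tasks \<tau> k {1..<k}"
    unfolding U[symmetric] long_period_tasks_def short_period_tasks_def by auto
  have fin: "finite (P m)" if "m \<in> {1..M}" for m
    using U that by (metis UN_upper finite_atLeastLessThan finite_subset)
  have task: "sporadic_task (\<tau> i)" if "i \<in> {1..k}" for i
    using assms(2,5) that by auto
  then have D: "?D > 0" and Ck: "wcet (\<tau> k) > 0"
    using assms(5) by (auto simp: sporadic_task_def)
  have w: "wcet (\<tau> i) \<ge> 0" "utilization (\<tau> i) \<ge> 0" if "i \<in> {1..<k}" for i
    using task[of i] that by (auto simp: sporadic_task_def utilization_def)
  have infl: "inflated_wcet M \<tau> k / ?D = wcet (\<tau> k) / ?D
      + (\<Sum>i\<in>long_period_tasks \<tau> k {1..<k}. wcet (\<tau> i) / ?D) / real M"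
    by (simp add: inflated_wcet_def add_divide_distrib sum_divide_distrib[symmetric])
  \<comment> \<open>This makes the denominator in the hypothesis positive, so that it can be
    cleared.\<close>
  have "inflated_wcet M \<tau> k / ?D \<ge> 0"
    unfolding infl using D Ck w
    by (intro add_nonneg_nonneg divide_nonneg_nonneg sum_nonneg)
       (auto simp: long_period_tasks_def)
  then have "(1 + inflated_wcet M \<tau> k / ?D)
      * (\<Prod>i\<in>short_period_tasks \<tau> k {1..<k}. 1 + utilization (\<tau> i) / real M) \<le> 2"
    using assms(7) by (simp add: pos_le_divide_eq mult.commute)
  then have "\<exists>m\<in>{1..M}. (1 + wcet (\<tau> k) / ?D + (\<Sum>i\<in>?L m. wcet (\<tau> i) / ?D))
      * (\<Prod>i\<in>?S m. 1 + utilization (\<tau> i)) \<le> 2"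
  \<comment> \<open>Here \<open>a\<close> is \<open>wcet (\<tau> k) / ?D\<close> and
    \<open>c i\<close> is \<open>wcet (\<tau> i) / ?D\<close>; case 10 is the cleared hypothesis,
    the others are side conditions.\<close>
  proof (intro exists_passing_part, goal_cases)
    case (3 m)
    then show ?case using fin by (simp add: long_period_tasks_def)
  next
    case 4
    show ?case
      using disj by (auto simp: disjoint_family_on_def long_period_tasks_def)
  next
    case (5 m)
    then show ?case using fin by (simp add: short_period_tasks_def)
  next
    case 6
    show ?case
      using disj by (auto simp: disjoint_family_on_def short_period_tasks_def)
  next
    case (8 i)
    then show ?case using w D unfolding L by (simp add: long_period_tasks_def)
  next
    case (9 i)
    then show ?case using w unfolding S by (simp add: short_period_tasks_def)
  next
    case 10
    then show ?case unfolding L S infl by (simp add: add.assoc)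
  qed (use assms(1) D Ck in auto)
  then have "\<exists>m\<in>{1..M}. ?test (P m) k"
    by (simp add: hyperbolic_test_def add_divide_distrib sum_divide_distrib add_ac)
  then have ne: "passing_processors M ?test P k \<noteq> {}"
    by (auto simp: passing_processors_def)
  \<comment> \<open>The witness has to be the processor picked by the strategy, which may differ
    from the passing one just found.\<close>
  define m where "m = sel P k (passing_processors M ?test P k)"
  have "passing_processors M ?test P k \<subseteq> {1..M}"
    by (auto simp: passing_processors_def)
  then have "m \<in> passing_processors M ?test P k"
    using assms(4) ne by (simp add: fitting_strategy_def m_def)
  \<comment> \<open>Since \<open>k \<ge> 2\<close>, the recursive equation of
    \<open>dm_partition\<close> applies, with \<open>k - 1 = Suc n\<close>.\<close>
  moreover obtain n where "k = Suc (Suc n)"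
    using assms(5) by (metis atLeastAtMost_iff add_2_eq_Suc le_Suc_ex)
  then have "dm_partition M ?test sel k = Some (assign P m k)"
    using assms(6) ne by (simp add: m_def)
  ultimately show ?thesis by (auto simp: passing_processors_def)
qed

end
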